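(* Let $\mathcal D\subset\mathbb R^n$ be a convex compact set, let $f:\mathbb R^n\to\mathbb R$ be an everywhere-differentiable function, and let $f^*=\min_{x\in\mathcal D}f(x)$. Suppose that $\gamma(t)=\frac{c}{c+t}$ for some constant $c\ge 1$. Then the continuous-time Frank-Wolfe flow $$\dot x(t)=\gamma(t)\,(s(t)-x(t)),\qquad s(t)\in\operatorname*{argmin}_{s\in\mathcal D}\nabla f(x(t))^T(s-x(t)),$$ satisfies the upper bound $$\frac{f(x(t))-f^*}{f(x(0))-f^*}\le\left(\frac{c}{c+t}\right)^c=O\!\left(\frac1{t^c}\right).$$
   Context: The differential inclusion in the claim is the continuous-time version of the Frank-Wolfe method for the problem of minimizing $f(x)$ over $x\in\mathcal D$.
   Formalization: The formal theorem additionally assumes that f is convex on D and that x(0) lies in D; without these the bound fails (f(y)=y^3 on [-1,1] with x=s=0; f(y)=y^2+2y on [0,1] with x(0)=-1/2). *)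

theory Defs
  imports "HOL-Analysis.Analysis"
begin

definition gradient :: "('a::euclidean_space \<Rightarrow> real) \<Rightarrow> 'a \<Rightarrow> 'a" where
  "gradient f x = (THE g. GDERIV f x :> g)"

text \<open>Absolute continuity on \<open>{l..u}\<close>, by finite families of non-overlapping subintervals
  \<open>{a i..b i}\<close>; degenerate members (\<open>a i = b i\<close>) contribute \<open>0\<close> to both sums.\<close>

definition abs_continuous_on_interval ::
    "real \<Rightarrow> real \<Rightarrow> (real \<Rightarrow> 'a::metric_space) \<Rightarrow> bool" where
  "abs_continuous_on_interval l u x \<longleftrightarrow>
    (\<forall>\<epsilon>>0. \<exists>\<delta>>0. \<forall>(N::nat) a b.
       (\<forall>i<N. l \<le> a i \<and> a i \<le> b i \<and> b i \<le> u) \<and>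
       disjoint_family_on (\<lambda>i. {a i<..<b i}) {..<N} \<and>
       (\<Sum>i<N. b i - a i) < \<delta>
       \<longrightarrow> (\<Sum>i<N. dist (x (a i)) (x (b i))) < \<epsilon>)"

text \<open>A trajectory of the Frank--Wolfe differential inclusion on \<open>[0,\<infinity>)\<close>, in the usual
  (Caratheodory) sense: \<open>x\<close> is locally absolutely continuous and the inclusion holds for almost
  every time. The selection \<open>s\<close> typically jumps, so \<open>x\<close> need not be differentiable at every time;
  classical solutions are a special case.\<close>

definition frank_wolfe_flow ::
    "'a::euclidean_space set \<Rightarrow> ('a \<Rightarrow> real) \<Rightarrow> (real \<Rightarrow> real) \<Rightarrow> (real \<Rightarrow> 'a) \<Rightarrow> (real \<Rightarrow> 'a) \<Rightarrow> bool"
where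
  "frank_wolfe_flow D f \<gamma> s x \<longleftrightarrow>
    (\<forall>T\<ge>0. abs_continuous_on_interval 0 T x) \<and>
    (AE t in lebesgue_on {0..}.
       (x has_vector_derivative \<gamma> t *\<^sub>R (s t - x t)) (at t) \<and>
       is_arg_min (\<lambda>v. gradient f (x t) \<bullet> (v - x t)) (\<lambda>v. v \<in> D) (s t))"

end

theory Submission
  imports Defs
begin

text \<open>
  Minimality of \<open>s\<close> and convexity give \<open>\<nabla>f(x) \<bullet> (s - x) \<le> f\<^sup>* - f(x)\<close>, so
  \<open>(f(x(t)) - f\<^sup>*) (c + t)\<^sup>c\<close> has nonpositive derivative almost everywhere. Since \<open>f\<close> need not be
  Lipschitz on \<open>D\<close>, its composition with \<open>x\<close> need not be absolutely continuous. But \<open>x\<close> is locally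
  Lipschitz and \<open>f\<close> is differentiable at every point of the trajectory, so the increments of \<open>f \<circ> x\<close>
  at each time \<open>t\<close> are \<open>O(u - t)\<close>; hence it maps null sets to null sets, which suffices for
  monotonicity. The same decay estimate for half-spaces containing \<open>D\<close> keeps \<open>x\<close> in \<open>D\<close>.
\<close>

section \<open>Absolute continuity on intervals\<close>

lemma abs_continuous_on_intervalE:
  assumes "abs_continuous_on_interval l u x" "e > 0"
  obtains d where "d > 0"
    "\<And>(N::nat) a b. (\<And>i. i < N \<Longrightarrow> l \<le> a i \<and> a i \<le> b i \<and> b i \<le> u) \<Longrightarrow>
       disjoint_family_on (\<lambda>i. {a i<..<b i}) {..<N} \<Longrightarrow> (\<Sum>i<N. b i - a i) < d \<Longrightarrow>
       (\<Sum>i<N. dist (x (a i)) (x (b i))) < e"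
proof -
  have "\<exists>d>0. \<forall>(N::nat) a b. (\<forall>i<N. l \<le> a i \<and> a i \<le> b i \<and> b i \<le> u) \<and>
       disjoint_family_on (\<lambda>i. {a i<..<b i}) {..<N} \<and> (\<Sum>i<N. b i - a i) < d \<longrightarrow>
       (\<Sum>i<N. dist (x (a i)) (x (b i))) < e"
    using assms unfolding abs_continuous_on_interval_def by (elim allE impE)
  then obtain d where "d > 0" and d: "\<forall>(N::nat) a b. (\<forall>i<N. l \<le> a i \<and> a i \<le> b i \<and> b i \<le> u) \<and>
       disjoint_family_on (\<lambda>i. {a i<..<b i}) {..<N} \<and> (\<Sum>i<N. b i - a i) < d \<longrightarrow>
       (\<Sum>i<N. dist (x (a i)) (x (b i))) < e"
    by (elim exE conjE)
  show ?thesis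
  proof (rule that[OF \<open>d > 0\<close>])
    fix N :: nat and a b
    assume "\<And>i. i < N \<Longrightarrow> l \<le> a i \<and> a i \<le> b i \<and> b i \<le> u"
      "disjoint_family_on (\<lambda>i. {a i<..<b i}) {..<N}" "(\<Sum>i<N. b i - a i) < d"
    then show "(\<Sum>i<N. dist (x (a i)) (x (b i))) < e"
      by (intro d[rule_format]) blast
  qed
qed

lemma abs_continuous_on_interval_subset:
  assumes "abs_continuous_on_interval l u x" "l \<le> l'" "u' \<le> u"
  shows "abs_continuous_on_interval l' u' x"
  unfolding abs_continuous_on_interval_def
proof (intro allI impI)
  fix e :: real assume "e > 0"
  obtain d where "d > 0" and d: "\<And>(N::nat) a b.
      (\<And>i. i < N \<Longrightarrow> l \<le> a i \<and> a i \<le> b i \<and> b i \<le> u) \<Longrightarrow>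
      disjoint_family_on (\<lambda>i. {a i<..<b i}) {..<N} \<Longrightarrow> (\<Sum>i<N. b i - a i) < d \<Longrightarrow>
      (\<Sum>i<N. dist (x (a i)) (x (b i))) < e"
    by (erule abs_continuous_on_intervalE[OF assms(1) \<open>e > 0\<close>])
  show "\<exists>d>0. \<forall>(N::nat) a b.
       (\<forall>i<N. l' \<le> a i \<and> a i \<le> b i \<and> b i \<le> u') \<and>
       disjoint_family_on (\<lambda>i. {a i<..<b i}) {..<N} \<and>
       (\<Sum>i<N. b i - a i) < d
       \<longrightarrow> (\<Sum>i<N. dist (x (a i)) (x (b i))) < e"
  proof (intro exI[of _ d] conjI allI impI)
    fix N :: nat and a b
    assume *: "(\<forall>i<N. l' \<le> a i \<and> a i \<le> b i \<and> b i \<le> u') \<and>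
       disjoint_family_on (\<lambda>i. {a i<..<b i}) {..<N} \<and> (\<Sum>i<N. b i - a i) < d"
    show "(\<Sum>i<N. dist (x (a i)) (x (b i))) < e"
    proof (rule d)
      fix i assume "i < N"
      then show "l \<le> a i \<and> a i \<le> b i \<and> b i \<le> u"
        using * assms(2,3) by (meson order_trans)
    qed (use * in simp_all)
  qed fact
qed

lemma abs_continuous_imp_continuous_on:
  assumes "abs_continuous_on_interval l u x"
  shows "continuous_on {l..u} x"
  unfolding continuous_on_iff
proof (intro ballI allI impI)
  fix t e :: real assume t: "t \<in> {l..u}" and "e > 0"
  obtain d where "d > 0" and d: "\<And>(N::nat) a b.
      (\<And>i. i < N \<Longrightarrow> l \<le> a i \<and> a i \<le> b i \<and> b i \<le> u) \<Longrightarrow>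
      disjoint_family_on (\<lambda>i. {a i<..<b i}) {..<N} \<Longrightarrow> (\<Sum>i<N. b i - a i) < d \<Longrightarrow>
      (\<Sum>i<N. dist (x (a i)) (x (b i))) < e"
    by (erule abs_continuous_on_intervalE[OF assms(1) \<open>e > 0\<close>])
  show "\<exists>d>0. \<forall>t'\<in>{l..u}. dist t' t < d \<longrightarrow> dist (x t') (x t) < e"
  proof (intro exI[of _ d] conjI ballI impI)
    fix t' assume t': "t' \<in> {l..u}" "dist t' t < d"
    \<comment> \<open>A family with a single interval suffices; \<open>min\<close> and
      \<open>max\<close> orient it, since \<open>t'\<close> may lie on either side of
      \<open>t\<close>.\<close>
    have "(\<Sum>i<1::nat. dist (x (min t t')) (x (max t t'))) < e"
      using t t' by (intro d) (auto simp: disjoint_family_on_def dist_real_def)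
    then show "dist (x t') (x t) < e"
      by (auto simp: min_def max_def dist_commute split: if_splits)
  qed fact
qed

section \<open>Absolute continuity over tagged divisions and the mean value bound\<close>

text \<open>The intervals of a partial division do not overlap, so they form an admissible family
  for absolute continuity. This is the form in which absolute continuity meets gauge-fine
  divisions.\<close>

lemma abs_continuous_tagged_partial_division:
  fixes x :: "real \<Rightarrow> 'a::metric_space"
  assumes ac: "abs_continuous_on_interval l u x" and "e > 0"
  obtains d where "d > 0"
    "\<And>q. q tagged_partial_division_of {l..u} \<Longrightarrow> (\<Sum>(t,K)\<in>q. Sup K - Inf K) < d
      \<Longrightarrow> (\<Sum>(t,K)\<in>q. dist (x (Inf K)) (x (Sup K))) < e"
proof -
  obtain d where "d > 0" and d: "\<And>(N::nat) a b.
      (\<And>i. i < N \<Longrightarrow> l \<le> a i \<and> a i \<le> b i \<and> b i \<le> u) \<Longrightarrow>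
      disjoint_family_on (\<lambda>i. {a i<..<b i}) {..<N} \<Longrightarrow> (\<Sum>i<N. b i - a i) < d \<Longrightarrow>
      (\<Sum>i<N. dist (x (a i)) (x (b i))) < e"
    by (erule abs_continuous_on_intervalE[OF ac \<open>e > 0\<close>])
  show ?thesis
  proof (rule that[OF \<open>d > 0\<close>])
    fix q :: "(real \<times> real set) set"
    assume q: "q tagged_partial_division_of {l..u}" and less: "(\<Sum>(t,K)\<in>q. Sup K - Inf K) < d"
    have fin: "finite q" using q by (simp add: tagged_partial_division_of_def)
    define N where "N = card q"
    \<comment> \<open>The definition speaks of families indexed by an initial segment of the
      naturals, so the finite set \<open>q\<close> is enumerated.\<close>
    obtain h where h: "bij_betw h {..<N} q"
      using ex_bij_betw_nat_finite[OF fin] by (auto simp: N_def atLeast0LessThan)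
    define a where "a i = Inf (snd (h i))" for i
    define b where "b i = Sup (snd (h i))" for i
    have K: "\<exists>v w. v \<le> w \<and> K = {v..w} \<and> l \<le> v \<and> w \<le> u" if "(t, K) \<in> q" for t K
    proof -
      obtain v w where vw: "K = cbox v w"
        using q \<open>(t, K) \<in> q\<close> unfolding tagged_partial_division_of_def by meson
      have "t \<in> K" "K \<subseteq> {l..u}" using q that unfolding tagged_partial_division_of_def by blast+
      with vw show ?thesis by (intro exI[of _ v] exI[of _ w]) auto
    qed
    have hq: "(fst (h i), snd (h i)) \<in> q" if "i < N" for i
      using bij_betwE[OF h] that by simp
    have hK: "snd (h i) = {a i..b i}" "l \<le> a i \<and> a i \<le> b i \<and> b i \<le> u" if i: "i < N" for i
    proof -
      obtain v w where "v \<le> w" "snd (h i) = {v..w}" "l \<le> v" "w \<le> u" using K[OF hq[OF i]] by blast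
      then show "snd (h i) = {a i..b i}" "l \<le> a i \<and> a i \<le> b i \<and> b i \<le> u"
        by (simp_all add: a_def b_def)
    qed
    have "disjoint_family_on (\<lambda>i. {a i<..<b i}) {..<N}"
      unfolding disjoint_family_on_def
    proof (intro ballI impI)
      fix i j assume ij: "i \<in> {..<N}" "j \<in> {..<N}" "i \<noteq> j"
      then have "h i \<noteq> h j" using bij_betw_imp_inj_on[OF h] by (auto dest: inj_onD)
      then have "(fst (h i), snd (h i)) \<noteq> (fst (h j), snd (h j))" by simp
      with ij have "interior (snd (h i)) \<inter> interior (snd (h j)) = {}"
        by (intro tagged_partial_division_ofD(5)[OF q hq hq]) simp_all
      then show "{a i<..<b i} \<inter> {a j<..<b j} = {}"
        using hK(1)[of i] hK(1)[of j] ij by simp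
    qed
    moreover have "(\<Sum>i<N. b i - a i) = (\<Sum>(t,K)\<in>q. Sup K - Inf K)"
      unfolding a_def b_def using sum.reindex_bij_betw[OF h, of "\<lambda>(t,K). Sup K - Inf K"]
      by (simp add: case_prod_unfold)
    ultimately have "(\<Sum>i<N. dist (x (a i)) (x (b i))) < e"
      using less by (intro d hK(2)) simp_all
    also have "(\<Sum>i<N. dist (x (a i)) (x (b i))) = (\<Sum>(t,K)\<in>q. dist (x (Inf K)) (x (Sup K)))"
      unfolding a_def b_def
      using sum.reindex_bij_betw[OF h, of "\<lambda>(t,K). dist (x (Inf K)) (x (Sup K))"]
      by (simp add: case_prod_unfold)
    finally show "(\<Sum>(t,K)\<in>q. dist (x (Inf K)) (x (Sup K))) < e" .
  qed
qed

text \<open>Non-overlapping intervals have as total length the measure of their union, and this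
  union lies in \<open>T\<close>.\<close>

lemma tagged_partial_division_length_le:
  fixes q :: "(real \<times> real set) set"
  assumes q: "q tagged_partial_division_of {l..u}"
    and sub: "\<And>t K. (t, K) \<in> q \<Longrightarrow> K \<subseteq> T" and T: "T \<in> lmeasurable"
  shows "(\<Sum>(t,K)\<in>q. Sup K - Inf K) \<le> measure lebesgue T"
proof -
  have tag: "q tagged_division_of \<Union>(snd ` q)"
    using q by (rule tagged_partial_division_of_Union_self)
  then have div: "snd ` q division_of \<Union>(snd ` q)" by (rule division_of_tagged_division)
  have "(\<Sum>(t,K)\<in>q. Sup K - Inf K) = (\<Sum>(t,K)\<in>q. measure lebesgue K)"
  proof (intro sum.cong refl, clarify)
    fix t K assume tK: "(t, K) \<in> q"
    then obtain v w where "K = cbox v w" "t \<in> K"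
      using q unfolding tagged_partial_division_of_def by meson
    then show "Sup K - Inf K = measure lebesgue K" by auto
  qed
  \<comment> \<open>Passing from pairs to intervals may merge pairs with different tags and the same
    interval; such an interval has empty interior, hence length 0.\<close>
  also have "\<dots> = (\<Sum>K\<in>snd ` q. measure lebesgue K)"
    by (rule sum.over_tagged_division_lemma[OF tag])
       (auto simp: content_eq_0_interior)
  also have "\<dots> = measure lebesgue (\<Union>(snd ` q))"
    using div by (rule content_division)
  also have "\<dots> \<le> measure lebesgue T"
  proof (rule measure_mono_fmeasurable[OF _ _ T])
    show "\<Union>(snd ` q) \<subseteq> T" by (auto dest!: sub)
    show "\<Union>(snd ` q) \<in> sets lebesgue"
      using lmeasurable_division[OF div] by (rule fmeasurableD)
  qed
  finally show ?thesis .
qed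

text \<open>Tags outside \<open>N\<close> are controlled by the derivative; the intervals tagged in \<open>N\<close> have small
  total length, so absolute continuity controls their increments.\<close>

proposition abs_continuous_vector_derivative_bound:
  fixes x :: "real \<Rightarrow> 'a::real_normed_vector"
  assumes ac: "abs_continuous_on_interval a b x" and "a \<le> b" and N: "negligible N" and "M \<ge> 0"
    and der: "\<And>t. t \<in> {a..b} - N \<Longrightarrow>
      \<exists>d. (x has_vector_derivative d) (at t within {a..b}) \<and> norm d \<le> M"
  shows "norm (x b - x a) \<le> M * (b - a)"
proof (rule field_le_epsilon)
  fix e' :: real assume "e' > 0"
  \<comment> \<open>Two errors will arise: \<open>e * (b - a)\<close> from the tags outside
    \<open>N\<close> and \<open>e\<close> from the tags in \<open>N\<close>. With this choice they
    add up to \<open>e'\<close>.\<close>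
  define e where "e = e' / (b - a + 1)"
  have "e > 0" and e'_eq: "e' = e * (b - a + 1)"
    using \<open>e' > 0\<close> \<open>a \<le> b\<close> by (simp_all add: e_def)
  obtain d where "d > 0" and d: "\<And>q. q tagged_partial_division_of {a..b} \<Longrightarrow>
      (\<Sum>(t,K)\<in>q. Sup K - Inf K) < d \<Longrightarrow> (\<Sum>(t,K)\<in>q. dist (x (Inf K)) (x (Sup K))) < e"
    by (erule abs_continuous_tagged_partial_division[OF ac \<open>e > 0\<close>])
  obtain U where U: "open U" "N \<subseteq> U" "U \<in> lmeasurable" "measure lebesgue U < d"
  proof -
    have "N \<in> sets lebesgue" using N by (simp add: negligible_imp_sets)
    then obtain T where T: "open T" "N \<subseteq> T" "T - N \<in> lmeasurable" "emeasure lebesgue (T - N) < ennreal d"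
      using sets_lebesgue_outer_open \<open>d > 0\<close> by blast
    \<comment> \<open>Outer regularity makes \<open>T - N\<close> small; as \<open>N\<close> is
      null, \<open>T\<close> has the same measure and can serve as \<open>U\<close>.\<close>
    have sym: "negligible (sym_diff (T - N) T)"
      by (rule negligible_subset[OF N]) auto
    have "T \<in> lmeasurable"
      using T(3) sym by (rule lmeasurable_negligible_symdiff)
    moreover have "measure lebesgue T = measure lebesgue (T - N)"
      using T(3) sym by (rule measure_negligible_symdiff)
    moreover have "measure lebesgue (T - N) < d"
      using T(3,4) \<open>d > 0\<close> by (simp add: emeasure_eq_measure2 ennreal_less_iff)
    ultimately show ?thesis using that T by auto
  qed
  \<comment> \<open>The gauge has two tasks: at a tag in \<open>N\<close> it confines the interval
    to \<open>U\<close>, and at any other tag it makes the linear approximation accurate up to slope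
    \<open>e\<close>.\<close>
  have "\<exists>r>0. (t \<in> N \<longrightarrow> ball t r \<subseteq> U) \<and> (t \<in> {a..b} - N \<longrightarrow>
      (\<forall>y\<in>{a..b}. dist t y < r \<longrightarrow> norm (x y - x t) \<le> (M + e) * \<bar>y - t\<bar>))" for t
  proof (cases "t \<in> N")
    case True
    then show ?thesis using U(1,2) by (metis DiffD2 openE subsetD)
  next
    case False
    show ?thesis
    proof (cases "t \<in> {a..b}")
      case True
      with False obtain d where d: "(x has_vector_derivative d) (at t within {a..b})" "norm d \<le> M"
        using der by blast
      then obtain r where "r > 0" and r: "\<And>y. y \<in> {a..b} \<Longrightarrow> \<bar>y - t\<bar> < r \<Longrightarrow>
          norm (x y - x t - (y - t) *\<^sub>R d) \<le> e * \<bar>y - t\<bar>"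
        using \<open>e > 0\<close> unfolding has_vector_derivative_def has_derivative_within_alt by fastforce
      have "norm (x y - x t) \<le> (M + e) * \<bar>y - t\<bar>" if "y \<in> {a..b}" "dist t y < r" for y
      proof -
        have "norm (x y - x t - (y - t) *\<^sub>R d) \<le> e * \<bar>y - t\<bar>"
          using that by (intro r) (auto simp: dist_real_def)
        moreover have "norm ((y - t) *\<^sub>R d) \<le> M * \<bar>y - t\<bar>"
          using d(2) by (simp add: mult.commute mult_right_mono)
        ultimately show ?thesis
          using norm_triangle_sub[of "x y - x t" "(y - t) *\<^sub>R d"] by (simp add: distrib_right)
      qed
      with \<open>r > 0\<close> False show ?thesis by blast
    qed (use False in \<open>auto intro: exI[of _ 1]\<close>)
  qed
  then obtain r where r: "\<And>t. r t > 0" "\<And>t. t \<in> N \<Longrightarrow> ball t (r t) \<subseteq> U"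
    "\<And>t y. t \<in> {a..b} - N \<Longrightarrow> y \<in> {a..b} \<Longrightarrow> dist t y < r t \<Longrightarrow>
        norm (x y - x t) \<le> (M + e) * \<bar>y - t\<bar>"
    by metis
  have "gauge (\<lambda>t. ball t (r t))" using r(1) by (simp add: gauge_ball_dependent)
  then obtain p where p: "p tagged_division_of {a..b}" and fine: "(\<lambda>t. ball t (r t)) fine p"
    using fine_division_exists_real by blast
  define q where "q = {tK \<in> p. fst tK \<in> N}"
  have fin: "finite p" using p by auto
  have Kp: "\<exists>v w. K = {v..w} \<and> v \<le> t \<and> t \<le> w \<and> a \<le> v \<and> w \<le> b \<and> K \<subseteq> ball t (r t)" if "(t, K) \<in> p" for t K
  proof -
    obtain v w where vw: "K = cbox v w"
      using tagged_division_ofD(4)[OF p \<open>(t, K) \<in> p\<close>] by blast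
    have "t \<in> K" "K \<subseteq> {a..b}" "K \<subseteq> ball t (r t)"
      using tagged_division_ofD(2,3)[OF p that] fineD[OF fine that] by blast+
    with vw show ?thesis by (intro exI[of _ v] exI[of _ w]) auto
  qed
  have q: "q tagged_partial_division_of {a..b}"
    using p by (auto simp: q_def tagged_division_of_def intro: tagged_partial_division_subset)
  have "(\<Sum>(t,K)\<in>q. Sup K - Inf K) \<le> measure lebesgue U"
  proof (rule tagged_partial_division_length_le[OF q _ U(3)])
    fix t K assume "(t, K) \<in> q"
    then have "t \<in> N" "(t, K) \<in> p" by (auto simp: q_def)
    then show "K \<subseteq> U" using Kp[of t K] r(2)[of t] by blast
  qed
  then have sq: "(\<Sum>(t,K)\<in>q. norm (x (Sup K) - x (Inf K))) < e"
    using d[OF q] U(4) by (simp add: dist_norm norm_minus_commute)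
  \<comment> \<open>Both endpoints are compared with the tag. As the tag lies between them, the two
    distances add up to the length of the interval.\<close>
  have "norm (x (Sup K) - x (Inf K)) \<le> (M + e) * (Sup K - Inf K)" if "(t, K) \<in> p - q" for t K
  proof -
    obtain v w where K: "K = {v..w}" "v \<le> t" "t \<le> w" "a \<le> v" "w \<le> b" "K \<subseteq> ball t (r t)"
      using Kp \<open>(t, K) \<in> p - q\<close> by blast
    have t: "t \<in> {a..b} - N" using K that by (auto simp: q_def)
    have "v \<in> {v..w}" "w \<in> {v..w}" using K by auto
    with K(1,6) have "v \<in> ball t (r t)" "w \<in> ball t (r t)" by blast+
    then have "norm (x v - x t) \<le> (M + e) * \<bar>v - t\<bar>" "norm (x w - x t) \<le> (M + e) * \<bar>w - t\<bar>"
      using r(3)[OF t, of v] r(3)[OF t, of w] K by auto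
    then have "norm (x w - x v) \<le> (M + e) * \<bar>w - t\<bar> + (M + e) * \<bar>v - t\<bar>"
      using norm_triangle_ineq4[of "x w - x t" "x v - x t"] by simp
    also have "\<dots> = (M + e) * (w - v)" using K by (simp add: algebra_simps)
    finally show ?thesis using K by simp
  qed
  then have "(\<Sum>(t,K)\<in>p - q. norm (x (Sup K) - x (Inf K))) \<le> (\<Sum>(t,K)\<in>p - q. (M + e) * (Sup K - Inf K))"
    by (intro sum_mono) auto
  also have "\<dots> \<le> (\<Sum>(t,K)\<in>p. (M + e) * (Sup K - Inf K))"
  proof (rule sum_mono2[OF fin])
    fix tK assume "tK \<in> p - (p - q)"
    then show "0 \<le> (case tK of (t, K) \<Rightarrow> (M + e) * (Sup K - Inf K))"
      using Kp[of "fst tK" "snd tK"] \<open>M \<ge> 0\<close> \<open>e > 0\<close> by (auto simp: case_prod_unfold)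
  qed auto
  also have "\<dots> = (M + e) * (b - a)"
    using additive_tagged_division_1[OF \<open>a \<le> b\<close> p, of "\<lambda>t. t"]
    by (simp add: sum_distrib_left case_prod_unfold flip: sum_distrib_left)
  finally have spq: "(\<Sum>(t,K)\<in>p - q. norm (x (Sup K) - x (Inf K))) \<le> (M + e) * (b - a)" .
  \<comment> \<open>The increments over the full division telescope; they are then split according
    to whether the tag lies in \<open>N\<close>.\<close>
  have "norm (x b - x a) = norm (\<Sum>(t,K)\<in>p. x (Sup K) - x (Inf K))"
    using additive_tagged_division_1[OF \<open>a \<le> b\<close> p, of x] by simp
  also have "\<dots> \<le> (\<Sum>(t,K)\<in>p. norm (x (Sup K) - x (Inf K)))"
    by (rule order_trans[OF norm_sum]) (simp add: case_prod_unfold)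
  also have "\<dots> = (\<Sum>(t,K)\<in>p - q. norm (x (Sup K) - x (Inf K))) + (\<Sum>(t,K)\<in>q. norm (x (Sup K) - x (Inf K)))"
    by (rule sum.subset_diff) (use fin in \<open>auto simp: q_def\<close>)
  also have "\<dots> \<le> (M + e) * (b - a) + e" using sq spq by simp
  also have "\<dots> = M * (b - a) + e'"
    unfolding e'_eq by (simp add: algebra_simps)
  finally show "norm (x b - x a) \<le> M * (b - a) + e'" .
qed

section \<open>Increments of linear order, monotonicity and decay\<close>

lemma increment_bigoD:
  fixes g :: "real \<Rightarrow> real"
  assumes "(\<lambda>u. g u - g t) \<in> O[at t within S](\<lambda>u. u - t)"
  obtains K where "\<forall>\<^sub>F u in at t within S. \<bar>g u - g t\<bar> \<le> K * \<bar>u - t\<bar>"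
proof -
  obtain K where "\<forall>\<^sub>F u in at t within S. norm (g u - g t) \<le> K * norm (u - t)"
    using landau_o.bigE[OF assms] .
  then show ?thesis using that by simp
qed

lemma increment_bigo_imp_continuous:
  fixes g :: "real \<Rightarrow> real"
  assumes "(\<lambda>u. g u - g t) \<in> O[at t within S](\<lambda>u. u - t)"
  shows "continuous (at t within S) g"
proof -
  obtain K where K: "\<forall>\<^sub>F u in at t within S. norm (g u - g t) \<le> K * \<bar>u - t\<bar>"
    using increment_bigoD[OF assms] unfolding real_norm_def .
  have "((\<lambda>u. K * \<bar>u - t\<bar>) \<longlongrightarrow> K * \<bar>t - t\<bar>) (at t within S)"
    by (intro tendsto_intros)
  then have "((\<lambda>u. K * \<bar>u - t\<bar>) \<longlongrightarrow> 0) (at t within S)"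
    by (simp only: diff_self abs_zero mult_zero_right)
  with K have "((\<lambda>u. g u - g t) \<longlongrightarrow> 0) (at t within S)"
    by (rule Lim_null_comparison)
  then show ?thesis
    unfolding continuous_within by (rule LIM_zero_cancel)
qed

lemma has_real_derivative_imp_increment_bigo:
  assumes "(w has_real_derivative d) (at t within S)"
  shows "(\<lambda>u. w u - w t) \<in> O[at t within S](\<lambda>u. u - t)"
proof (rule bigoI_tendsto)
  show "((\<lambda>u. (w u - w t) / (u - t)) \<longlongrightarrow> d) (at t within S)"
    using assms by (simp add: has_field_derivative_iff)
  show "\<forall>\<^sub>F u in at t within S. u - t \<noteq> 0"
    by (auto simp: eventually_at_filter)
qed

text \<open>As in the product rule, the increment splits into \<open>g u * (w u - w t)\<close> and
  \<open>w t * (g u - g t)\<close>; the factor \<open>g u\<close> stays bounded near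
  \<open>t\<close> by continuity.\<close>

lemma increment_bigo_mult:
  fixes g w :: "real \<Rightarrow> real"
  assumes g: "(\<lambda>u. g u - g t) \<in> O[at t within S](\<lambda>u. u - t)"
    and w: "(\<lambda>u. w u - w t) \<in> O[at t within S](\<lambda>u. u - t)"
  shows "(\<lambda>u. g u * w u - g t * w t) \<in> O[at t within S](\<lambda>u. u - t)"
proof -
  have "g \<in> O[at t within S](\<lambda>_. 1)"
    using increment_bigo_imp_continuous[OF g]
    by (intro bigoI_tendsto[where c = "g t"]) (auto simp: continuous_within)
  then have "(\<lambda>u. g u * (w u - w t)) \<in> O[at t within S](\<lambda>u. 1 * (u - t))"
    using w by (rule landau_o.big.mult)
  moreover have "(\<lambda>u. w t * (g u - g t)) \<in> O[at t within S](\<lambda>u. u - t)"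
    using g by simp
  ultimately have "(\<lambda>u. g u * (w u - w t) + w t * (g u - g t)) \<in> O[at t within S](\<lambda>u. u - t)"
    by (intro sum_in_bigo) simp_all
  then show ?thesis by (simp add: algebra_simps)
qed

text \<open>The image of the exceptional set is null, so some level strictly between the end values is
  crossed for the last time at a point where the (slightly tilted) function has negative derivative.\<close>

proposition nonincreasing_if_derivative_nonpos_ae:
  fixes h :: "real \<Rightarrow> real"
  assumes "a \<le> b" and N: "negligible N"
    and lip: "\<And>t. t \<in> {a..b} \<Longrightarrow> (\<lambda>u. h u - h t) \<in> O[at t within {a..b}](\<lambda>u. u - t)"
    and der: "\<And>t. t \<in> {a<..<b} - N \<Longrightarrow> \<exists>d\<le>0. (h has_real_derivative d) (at t)"
  shows "h b \<le> h a"
proof (rule ccontr)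
  assume "\<not> h b \<le> h a"
  with \<open>a \<le> b\<close> have "a < b" by (cases "a = b") auto
  \<comment> \<open>Half of the mean slope: subtracting it keeps \<open>g a < g b\<close>, while the
    derivative of \<open>g\<close> off \<open>N\<close> becomes at most \<open>- e\<close>, hence
    strictly negative.\<close>
  define e where "e = (h b - h a) / 2 / (b - a)"
  have "e > 0" using \<open>\<not> h b \<le> h a\<close> \<open>a < b\<close> by (simp add: e_def)
  define g where "g t = h t - e * (t - a)" for t
  have "e * (b - a) = (h b - h a) / 2"
    using nonzero_eq_divide_eq[THEN iffD1, OF _ e_def] \<open>a < b\<close> by simp
  then have gab: "g a < g b" using \<open>\<not> h b \<le> h a\<close> by (simp add: g_def field_simps)
  have lipg: "(\<lambda>u. g u - g t) \<in> O[at t within {a..b}](\<lambda>u. u - t)" if "t \<in> {a..b}" for t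
  proof -
    have "(\<lambda>u. (h u - h t) - e * (u - t)) \<in> O[at t within {a..b}](\<lambda>u. u - t)"
      using lip[OF that] by (rule sum_in_bigo) simp
    then show ?thesis by (simp add: g_def algebra_simps)
  qed
  have cont: "continuous_on {a..b} g"
    using increment_bigo_imp_continuous[OF lipg] by (simp add: continuous_on_eq_continuous_within)
  \<comment> \<open>A Lipschitz estimate centred at each single point suffices for null sets to have
    null images; both the constant and the neighbourhood may depend on the point.\<close>
  have "negligible (g ` (N \<inter> {a..b}))"
  proof (rule negligible_locally_Lipschitz_image)
    show "negligible (N \<inter> {a..b})" using N by (rule negligible_subset) auto
    fix t assume "t \<in> N \<inter> {a..b}"
    then obtain K where "\<forall>\<^sub>F u in at t within {a..b}. \<bar>g u - g t\<bar> \<le> K * \<bar>u - t\<bar>"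
      using increment_bigoD[OF lipg] by blast
    then obtain T where "open T" "t \<in> T"
      and T: "\<And>u. u \<in> T \<Longrightarrow> u \<noteq> t \<Longrightarrow> u \<in> {a..b} \<Longrightarrow> \<bar>g u - g t\<bar> \<le> K * \<bar>u - t\<bar>"
      unfolding eventually_at_topological by blast
    have "norm (g u - g t) \<le> K * norm (u - t)" if "u \<in> N \<inter> {a..b} \<inter> T" for u
      using T[of u] that by (cases "u = t") auto
    with \<open>open T\<close> \<open>t \<in> T\<close>
    show "\<exists>T B. open T \<and> t \<in> T \<and> (\<forall>u\<in>N \<inter> {a..b} \<inter> T. norm (g u - g t) \<le> B * norm (u - t))"
      by blast
  qed simp
  moreover have "\<not> negligible {g a<..<g b}"
    using gab by (simp add: negligible_interval(2)[of "g a" "g b", simplified])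
  ultimately have "\<not> {g a<..<g b} \<subseteq> g ` (N \<inter> {a..b})"
    using negligible_subset by blast
  then obtain y where y: "g a < y" "y < g b" "y \<notin> g ` (N \<inter> {a..b})"
    unfolding subset_iff greaterThanLessThan_iff by blast
  \<comment> \<open>The greatest element of this sublevel set is the last time at which
    \<open>g\<close> is at most \<open>y\<close>.\<close>
  define A where "A = {t \<in> {a..b}. g t \<le> y}"
  have "closed A"
    unfolding A_def using cont by (intro continuous_on_closed_Collect_le) (auto intro: continuous_intros)
  moreover have "bounded A"
    by (rule bounded_subset[OF bounded_closed_interval[of a b]]) (auto simp: A_def)
  ultimately have "compact A" by (simp add: compact_eq_bounded_closed)
  moreover have "a \<in> A" using y \<open>a < b\<close> by (simp add: A_def)
  ultimately obtain t where "t \<in> A" and max: "\<And>u. u \<in> A \<Longrightarrow> u \<le> t"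
    using compact_attains_sup[of A] by blast
  then have t: "a \<le> t" "t \<le> b" "g t \<le> y" by (auto simp: A_def)
  \<comment> \<open>If \<open>g t\<close> were below \<open>y\<close>, the intermediate value
    theorem would give a later time in \<open>A\<close>.\<close>
  have "g t = y"
  proof (rule ccontr)
    assume "g t \<noteq> y"
    moreover have "continuous_on {t..b} g" using cont by (rule continuous_on_subset) (use t in auto)
    ultimately obtain u where u: "t \<le> u" "u \<le> b" "g u = y"
      using IVT'[of g t y b] t y by auto
    then have "u \<in> A" using t by (simp add: A_def)
    with max[of u] u \<open>g t \<noteq> y\<close> show False by auto
  qed
  \<comment> \<open>The strict inequalities for \<open>y\<close> exclude the endpoints, and
    \<open>y\<close> was chosen outside the image of \<open>N\<close>.\<close>
  then have tab: "t \<in> {a<..<b} - N" using y t by (auto simp: less_le)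
  then obtain d where "d \<le> 0" "(h has_real_derivative d) (at t)" using der by blast
  then have "(g has_real_derivative d - e) (at t)"
    unfolding g_def by (auto intro!: derivative_eq_intros)
  then obtain r where "r > 0" and r: "\<And>k. 0 < k \<Longrightarrow> k < r \<Longrightarrow> g (t + k) < g t"
    using DERIV_neg_dec_right[of g "d - e" t] \<open>d \<le> 0\<close> \<open>e > 0\<close> by auto
  \<comment> \<open>A step short enough for \<open>g\<close> to have decreased and to remain inside
    \<open>{a..b}\<close>; it lands in \<open>A\<close> beyond its maximum.\<close>
  define k where "k = min (r / 2) (b - t)"
  have "0 < k" "k < r" "t + k \<le> b" using \<open>r > 0\<close> tab by (auto simp: k_def)
  then have "t + k \<in> A" using r[of k] t by (simp add: A_def)
  with max[of "t + k"] \<open>0 < k\<close> show False by simp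
qed

text \<open>\<open>(c + t) powr c\<close> is an integrating factor: its logarithmic derivative is
  \<open>c / (c + t)\<close>, so its product with \<open>g\<close> has nonpositive derivative off
  \<open>N\<close>. The sign of \<open>g\<close> is left free because the half-space argument starts
  from a negative value.\<close>

lemma decay_bound_ae:
  fixes g :: "real \<Rightarrow> real"
  assumes "c > 0" "T \<ge> 0" and N: "negligible N"
    and lip: "\<And>t. t \<in> {0..T} \<Longrightarrow> (\<lambda>u. g u - g t) \<in> O[at t within {0..T}](\<lambda>u. u - t)"
    and der: "\<And>t. t \<in> {0<..<T} - N \<Longrightarrow>
      \<exists>d. (g has_real_derivative d) (at t) \<and> d \<le> - (c / (c + t) * g t)"
  shows "g T * (c + T) powr c \<le> g 0 * c powr c"
proof -
  define w where "w t = (c + t) powr c" for t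
  have w: "(w has_real_derivative (c + t) powr c * (c / (c + t))) (at t)" if "t \<ge> 0" for t
    unfolding w_def using that \<open>c > 0\<close>
    by (auto intro!: derivative_eq_intros simp: powr_diff)
  have "g T * w T \<le> g 0 * w 0"
  proof (rule nonincreasing_if_derivative_nonpos_ae[OF \<open>T \<ge> 0\<close> N])
    fix t assume t: "t \<in> {0..T}"
    then have "(w has_real_derivative (c + t) powr c * (c / (c + t))) (at t within {0..T})"
      by (intro has_field_derivative_at_within[OF w]) simp
    then show "(\<lambda>u. g u * w u - g t * w t) \<in> O[at t within {0..T}](\<lambda>u. u - t)"
      by (intro increment_bigo_mult lip[OF t] has_real_derivative_imp_increment_bigo)
  next
    fix t assume t: "t \<in> {0<..<T} - N"
    then obtain d where d: "(g has_real_derivative d) (at t)" "d \<le> - (c / (c + t) * g t)"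
      using der by blast
    have "((\<lambda>u. g u * w u) has_real_derivative (d + c / (c + t) * g t) * w t) (at t)"
      using DERIV_mult[OF d(1) w[of t]] t by (simp add: w_def algebra_simps)
    moreover have "(d + c / (c + t) * g t) * w t \<le> 0"
      using d(2) by (intro mult_nonpos_nonneg) (simp_all add: w_def)
    ultimately show "\<exists>d\<le>0. ((\<lambda>u. g u * w u) has_real_derivative d) (at t)" by blast
  qed
  then show ?thesis by (simp add: w_def)
qed

section \<open>Gradients, convexity and composition with curves\<close>

text \<open>The definite description in \<open>gradient\<close> denotes: a representing vector
  exists for every linear functional, and uniqueness of the derivative makes it unique.\<close>

lemma differentiable_imp_GDERIV_gradient:
  fixes f :: "'a::euclidean_space \<Rightarrow> real"
  assumes "f differentiable (at x)"
  shows "GDERIV f x :> gradient f x"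
  unfolding gradient_def
proof (rule theI')
  obtain f' where f': "(f has_derivative f') (at x)"
    using assms by (auto simp: differentiable_def)
  \<comment> \<open>The Riesz vector: \<open>f' h = f' h * 1\<close>, and moving \<open>f'\<close>
    across the inner product gives \<open>h \<bullet> adjoint f' 1\<close>.\<close>
  define g where "g = adjoint f' 1"
  have "f' = (\<lambda>h. h \<bullet> g)"
    using adjoint_works[OF has_derivative_linear[OF f'], of _ 1] by (simp add: g_def fun_eq_iff)
  with f' have "GDERIV f x :> g" by (simp add: gderiv_def)
  moreover have "g = g'" if "GDERIV f x :> g" "GDERIV f x :> g'" for g g'
  proof -
    have "(\<lambda>h. h \<bullet> g) = (\<lambda>h. h \<bullet> g')"
      using that unfolding gderiv_def by (rule has_derivative_unique)
    then show ?thesis by (metis vector_eq_ldot)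
  qed
  ultimately show "\<exists>!g. GDERIV f x :> g" by blast
qed

lemma GDERIV_compose_curve:
  assumes "GDERIV F (x t) :> g" "(x has_vector_derivative v) (at t)"
  shows "((\<lambda>u. F (x u)) has_real_derivative v \<bullet> g) (at t)"
proof -
  have "((\<lambda>u. F (x u)) has_derivative (\<lambda>h. (h *\<^sub>R v) \<bullet> g)) (at t)"
    using assms unfolding gderiv_def has_vector_derivative_def
    by (intro has_derivative_compose[of x _ t UNIV F]) simp_all
  then show ?thesis by (simp add: has_field_derivative_def mult_commute_abs)
qed

text \<open>On the segment from \<open>z\<close> to \<open>y\<close>, convexity bounds the
  difference quotients at \<open>z\<close> by \<open>f y - f z\<close>; they tend to the directional
  derivative.\<close>

lemma convex_on_above_gradient:
  fixes f :: "'a::euclidean_space \<Rightarrow> real"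
  assumes "convex_on D f" "z \<in> D" "y \<in> D" and g: "GDERIV f z :> g"
  shows "(y - z) \<bullet> g \<le> f y - f z"
proof -
  define \<phi> where "\<phi> u = f ((1 - u) *\<^sub>R z + u *\<^sub>R y)" for u
  have "((\<lambda>u. (1 - u) *\<^sub>R z + u *\<^sub>R y) has_vector_derivative y - z) (at 0)"
    by (auto intro!: derivative_eq_intros simp: has_vector_derivative_def algebra_simps)
  then have "(\<phi> has_real_derivative (y - z) \<bullet> g) (at 0)"
    unfolding \<phi>_def using g by (intro GDERIV_compose_curve) simp_all
  then have "((\<lambda>u. (\<phi> u - \<phi> 0) / u) \<longlongrightarrow> (y - z) \<bullet> g) (at 0)"
    by (simp add: has_field_derivative_iff)
  \<comment> \<open>Only a right-hand limit can be used, since the segment parameter must stay in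
    the unit interval.\<close>
  then have lim: "((\<lambda>u. (\<phi> u - \<phi> 0) / u) \<longlongrightarrow> (y - z) \<bullet> g) (at_right 0)"
    by (rule tendsto_within_subset) simp
  have "\<forall>\<^sub>F u in at_right 0. u \<in> {0<..<1::real}"
    by (rule eventually_at_right_real) simp
  then have "\<forall>\<^sub>F u in at_right 0. (\<phi> u - \<phi> 0) / u \<le> f y - f z"
  proof eventually_elim
    case (elim u)
    then have "\<phi> u \<le> (1 - u) * f z + u * f y"
      unfolding \<phi>_def using assms by (intro convex_onD) auto
    then have "\<phi> u - \<phi> 0 \<le> (f y - f z) * u" by (simp add: \<phi>_def algebra_simps)
    with elim show ?case by (simp add: pos_divide_le_eq del: diff_divide_distrib)
  qed
  with lim show ?thesis by (rule tendsto_upperbound) simp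
qed

text \<open>Differentiability at the one point \<open>x t\<close> bounds the increments of
  \<open>F\<close> from there linearly in the displacement, and the displacement of the curve is
  linear in time. No Lipschitz constant of \<open>F\<close> on a neighbourhood enters.\<close>

lemma Lipschitz_curve_compose_increment_bigo:
  fixes x :: "real \<Rightarrow> 'a::real_normed_vector" and F :: "'a \<Rightarrow> real"
  assumes F: "F differentiable (at (x t))" and "t \<in> S"
    and lip: "\<And>u v. u \<in> S \<Longrightarrow> v \<in> S \<Longrightarrow> norm (x u - x v) \<le> L * \<bar>u - v\<bar>"
  shows "(\<lambda>u. F (x u) - F (x t)) \<in> O[at t within S](\<lambda>u. u - t)"
proof -
  obtain F' where F': "(F has_derivative F') (at (x t))"
    using F by (auto simp: differentiable_def)
  obtain B where "B > 0" and B: "\<And>v. norm (F' v) \<le> norm v * B"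
    using bounded_linear.pos_bounded[OF has_derivative_bounded_linear[OF F']] by blast
  \<comment> \<open>The definition of the derivative is applied with tolerance 1, which leads to the
    slope \<open>B + 1\<close>.\<close>
  obtain d where "d > 0" and d: "\<And>y. norm (y - x t) < d \<Longrightarrow>
      norm (F y - F (x t) - F' (y - x t)) \<le> 1 * norm (y - x t)"
    using F' unfolding has_derivative_within_alt by (metis UNIV_I zero_less_one)
  have lipS: "\<forall>\<^sub>F u in at t within S. norm (x u - x t) \<le> L * \<bar>u - t\<bar>"
    using lip \<open>t \<in> S\<close> by (auto simp: eventually_at_filter)
  have "((\<lambda>u. L * \<bar>u - t\<bar>) \<longlongrightarrow> L * \<bar>t - t\<bar>) (at t within S)"
    by (intro tendsto_intros)
  then have "\<forall>\<^sub>F u in at t within S. L * \<bar>u - t\<bar> < d"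
    by (rule order_tendstoD) (use \<open>d > 0\<close> in simp)
  with lipS have "\<forall>\<^sub>F u in at t within S. norm (F (x u) - F (x t)) \<le> ((B + 1) * L) * norm (u - t)"
  proof eventually_elim
    case (elim u)
    have "norm (F (x u) - F (x t)) \<le> norm (F' (x u - x t)) + norm (F (x u) - F (x t) - F' (x u - x t))"
      by (rule norm_triangle_sub)
    also have "\<dots> \<le> (B + 1) * norm (x u - x t)"
      using B[of "x u - x t"] d[of "x u"] elim by (simp add: algebra_simps)
    also have "\<dots> \<le> (B + 1) * (L * \<bar>u - t\<bar>)"
      using elim \<open>B > 0\<close> by (intro mult_left_mono) simp_all
    finally show ?case by (simp add: mult.assoc)
  qed
  then show ?thesis by (rule bigoI)
qed

section \<open>Trajectories of the flow: regularity, invariance of \<open>D\<close> and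
  decay\<close>

text \<open>One null set serves the differential equation and the minimality together, so that later
  arguments are pointwise off \<open>N\<close>.\<close>

lemma frank_wolfe_flowE:
  fixes x :: "real \<Rightarrow> 'a::euclidean_space"
  assumes "frank_wolfe_flow D f \<gamma> s x"
  obtains N where "negligible N"
    "\<And>t. t \<ge> 0 \<Longrightarrow> t \<notin> N \<Longrightarrow> (x has_vector_derivative \<gamma> t *\<^sub>R (s t - x t)) (at t)"
    "\<And>t. t \<ge> 0 \<Longrightarrow> t \<notin> N \<Longrightarrow> s t \<in> D"
    "\<And>t y. t \<ge> 0 \<Longrightarrow> t \<notin> N \<Longrightarrow> y \<in> D \<Longrightarrow>
      gradient f (x t) \<bullet> (s t - x t) \<le> gradient f (x t) \<bullet> (y - x t)"
proof -
  have "AE t in lebesgue_on {0..}.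
       (x has_vector_derivative \<gamma> t *\<^sub>R (s t - x t)) (at t) \<and>
       is_arg_min (\<lambda>v. gradient f (x t) \<bullet> (v - x t)) (\<lambda>v. v \<in> D) (s t)"
    using assms unfolding frank_wolfe_flow_def by (rule conjunct2)
  then have "AE t in lebesgue. t \<in> {0..} \<longrightarrow>
       (x has_vector_derivative \<gamma> t *\<^sub>R (s t - x t)) (at t) \<and>
       is_arg_min (\<lambda>v. gradient f (x t) \<bullet> (v - x t)) (\<lambda>v. v \<in> D) (s t)"
    by (rule AE_restrict_space_iff[THEN iffD1, rotated]) simp
  then obtain N where "negligible N" and N: "\<And>t. t \<ge> 0 \<Longrightarrow> t \<notin> N \<Longrightarrow>
       (x has_vector_derivative \<gamma> t *\<^sub>R (s t - x t)) (at t) \<and>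
       is_arg_min (\<lambda>v. gradient f (x t) \<bullet> (v - x t)) (\<lambda>v. v \<in> D) (s t)"
    unfolding eventually_ae_filter_negligible by auto
  with that[of N] show ?thesis by (auto simp: is_arg_min_def not_less)
qed

text \<open>The velocity is bounded off a null set, so the mean value bound for absolutely
  continuous curves applies. The bound on \<open>x\<close> comes from continuity on a compact time
  interval, because invariance of \<open>D\<close> is itself derived from this lemma.\<close>

lemma frank_wolfe_flow_Lipschitz:
  fixes x :: "real \<Rightarrow> 'a::euclidean_space"
  assumes flow: "frank_wolfe_flow D f \<gamma> s x" and "bounded D"
    and \<gamma>: "\<And>t. t \<ge> 0 \<Longrightarrow> \<bar>\<gamma> t\<bar> \<le> 1" and "T \<ge> 0"
  obtains L where "\<And>u v. u \<in> {0..T} \<Longrightarrow> v \<in> {0..T} \<Longrightarrow> norm (x u - x v) \<le> L * \<bar>u - v\<bar>"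
proof -
  have ac: "abs_continuous_on_interval 0 T x"
    using flow \<open>T \<ge> 0\<close> by (simp add: frank_wolfe_flow_def)
  obtain N where N: "negligible N"
    and xd: "\<And>t. t \<ge> 0 \<Longrightarrow> t \<notin> N \<Longrightarrow> (x has_vector_derivative \<gamma> t *\<^sub>R (s t - x t)) (at t)"
    and sD: "\<And>t. t \<ge> 0 \<Longrightarrow> t \<notin> N \<Longrightarrow> s t \<in> D"
    using frank_wolfe_flowE[OF flow] by metis
  have "bounded (x ` {0..T})"
    by (intro compact_imp_bounded compact_continuous_image abs_continuous_imp_continuous_on[OF ac]
        compact_Icc)
  then obtain B where "B > 0" and B: "\<And>t. t \<in> {0..T} \<Longrightarrow> norm (x t) \<le> B"
    unfolding bounded_pos by blast
  obtain B' where "B' > 0" and B': "\<And>y. y \<in> D \<Longrightarrow> norm y \<le> B'"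
    using \<open>bounded D\<close> unfolding bounded_pos by blast
  have le: "norm (x v - x u) \<le> (B' + B) * (v - u)" if "0 \<le> u" "u \<le> v" "v \<le> T" for u v
  proof (rule abs_continuous_vector_derivative_bound[OF _ \<open>u \<le> v\<close> N])
    show "abs_continuous_on_interval u v x"
      using abs_continuous_on_interval_subset[OF ac] that by simp
    show "0 \<le> B' + B" using \<open>B > 0\<close> \<open>B' > 0\<close> by simp
    fix t assume t: "t \<in> {u..v} - N"
    then have t': "t \<ge> 0" "t \<notin> N" "t \<in> {0..T}" using that by auto
    have "norm (s t - x t) \<le> B' + B"
      using norm_triangle_ineq4[of "s t" "x t"] B[OF t'(3)] B'[OF sD[OF t'(1,2)]] by simp
    then have "norm (\<gamma> t *\<^sub>R (s t - x t)) \<le> 1 * (B' + B)"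
      unfolding norm_scaleR using \<gamma>[OF t'(1)] by (intro mult_mono) simp_all
    then have "norm (\<gamma> t *\<^sub>R (s t - x t)) \<le> B' + B" by (simp only: mult_1)
    then show "\<exists>d. (x has_vector_derivative d) (at t within {u..v}) \<and> norm d \<le> B' + B"
      using has_vector_derivative_at_within[OF xd[OF t'(1,2)]] by blast
  qed
  show ?thesis
  proof (rule that)
    fix u v assume "u \<in> {0..T}" "v \<in> {0..T}"
    then show "norm (x u - x v) \<le> (B' + B) * \<bar>u - v\<bar>"
      using le[of u v] le[of v u] by (cases "u \<le> v") (auto simp: norm_minus_commute)
  qed
qed

text \<open>The signed distance to any half-space containing \<open>D\<close> obeys the decay bound, so the trajectory
  cannot cross its boundary.\<close>

lemma frank_wolfe_flow_stays:
  fixes D :: "'a::euclidean_space set"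
  assumes flow: "frank_wolfe_flow D f (\<lambda>t. c / (c + t)) s x"
    and "convex D" "compact D" "x 0 \<in> D" "c > 0" "T \<ge> 0"
  shows "x T \<in> D"
proof (rule ccontr)
  assume "x T \<notin> D"
  \<comment> \<open>Strict separation: \<open>\<beta> - a \<bullet> y\<close> is negative for
    \<open>y\<close> in \<open>D\<close> but positive at \<open>x T\<close>, which its decay along
    the trajectory will contradict.\<close>
  then obtain a \<beta> where a: "a \<bullet> x T < \<beta>" "\<And>y. y \<in> D \<Longrightarrow> \<beta> < a \<bullet> y"
    using separating_hyperplane_closed_point[of D "x T"] \<open>convex D\<close> \<open>compact D\<close>
    by (auto simp: compact_imp_closed)
  obtain N where N: "negligible N"
    and xd: "\<And>t. t \<ge> 0 \<Longrightarrow> t \<notin> N \<Longrightarrow> (x has_vector_derivative (c / (c + t)) *\<^sub>R (s t - x t)) (at t)"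
    and sD: "\<And>t. t \<ge> 0 \<Longrightarrow> t \<notin> N \<Longrightarrow> s t \<in> D"
    using frank_wolfe_flowE[OF flow] by metis
  have rate: "\<bar>c / (c + t)\<bar> \<le> 1" if "t \<ge> 0" for t
    using \<open>c > 0\<close> that by simp
  obtain L where L: "\<And>u v. u \<in> {0..T} \<Longrightarrow> v \<in> {0..T} \<Longrightarrow> norm (x u - x v) \<le> L * \<bar>u - v\<bar>"
    using frank_wolfe_flow_Lipschitz[OF flow compact_imp_bounded[OF \<open>compact D\<close>] rate \<open>T \<ge> 0\<close>]
    by metis
  have G: "GDERIV (\<lambda>y. \<beta> - a \<bullet> y) z :> - a" for z
    unfolding gderiv_def by (auto intro!: derivative_eq_intros simp: inner_commute)
  have "(\<beta> - a \<bullet> x T) * (c + T) powr c \<le> (\<beta> - a \<bullet> x 0) * c powr c"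
  proof (rule decay_bound_ae[OF \<open>c > 0\<close> \<open>T \<ge> 0\<close> N])
    fix t assume "t \<in> {0..T}"
    then show "(\<lambda>u. \<beta> - a \<bullet> x u - (\<beta> - a \<bullet> x t)) \<in> O[at t within {0..T}](\<lambda>u. u - t)"
      using G[of "x t"] L unfolding gderiv_def
      by (intro Lipschitz_curve_compose_increment_bigo[where F = "\<lambda>y. \<beta> - a \<bullet> y"])
         (auto simp: differentiable_def)
  next
    fix t assume "t \<in> {0<..<T} - N"
    then have t: "t \<ge> 0" "t \<notin> N" by auto
    have "((\<lambda>u. \<beta> - a \<bullet> x u) has_real_derivative ((c / (c + t)) *\<^sub>R (s t - x t)) \<bullet> (- a)) (at t)"
      using GDERIV_compose_curve[OF G xd[OF t]] .
    moreover have "((c / (c + t)) *\<^sub>R (s t - x t)) \<bullet> (- a) = (c / (c + t)) * (a \<bullet> x t - a \<bullet> s t)"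
      by (simp add: inner_diff_left inner_commute algebra_simps)
    moreover have "\<dots> \<le> (c / (c + t)) * (a \<bullet> x t - \<beta>)"
      using a(2)[OF sD[OF t]] t \<open>c > 0\<close> by (intro mult_left_mono) simp_all
    moreover have "\<dots> = - (c / (c + t) * (\<beta> - a \<bullet> x t))"
      by (simp only: mult_minus_right[symmetric] minus_diff_eq)
    ultimately show "\<exists>d. ((\<lambda>u. \<beta> - a \<bullet> x u) has_real_derivative d) (at t) \<and>
        d \<le> - (c / (c + t) * (\<beta> - a \<bullet> x t))"
      by metis
  qed
  also have "\<dots> \<le> 0"
    using a(2)[OF \<open>x 0 \<in> D\<close>] by (intro mult_nonpos_nonneg) simp_all
  finally have "\<beta> - a \<bullet> x T \<le> 0"
    using \<open>c > 0\<close> \<open>T \<ge> 0\<close> by (simp add: mult_le_0_iff)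
  with a(1) show False by simp
qed

text \<open>Minimality of \<open>s t\<close> tested against \<open>y\<close>, followed by the
  gradient inequality, bounds the slope of \<open>f\<close> along the flow by
  \<open>c / (c + t)\<close> times \<open>f y - f (x t)\<close>; the decay bound then applies to the
  gap.\<close>

lemma frank_wolfe_flow_decay:
  fixes D :: "'a::euclidean_space set"
  assumes flow: "frank_wolfe_flow D f (\<lambda>t. c / (c + t)) s x"
    and "convex D" "compact D" "x 0 \<in> D" "c > 0" "T \<ge> 0"
    and diff: "\<And>y. y \<in> D \<Longrightarrow> f differentiable (at y)" and conv: "convex_on D f" and "y \<in> D"
  shows "(f (x T) - f y) * (c + T) powr c \<le> (f (x 0) - f y) * c powr c"
proof -
  \<comment> \<open>Convexity and differentiability are given on \<open>D\<close>, so the trajectory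
    must first be known to stay there.\<close>
  have xD: "x t \<in> D" if "t \<ge> 0" for t
    using frank_wolfe_flow_stays assms that by blast
  obtain N where N: "negligible N"
    and xd: "\<And>t. t \<ge> 0 \<Longrightarrow> t \<notin> N \<Longrightarrow> (x has_vector_derivative (c / (c + t)) *\<^sub>R (s t - x t)) (at t)"
    and s: "\<And>t y. t \<ge> 0 \<Longrightarrow> t \<notin> N \<Longrightarrow> y \<in> D \<Longrightarrow>
      gradient f (x t) \<bullet> (s t - x t) \<le> gradient f (x t) \<bullet> (y - x t)"
    using frank_wolfe_flowE[OF flow] by metis
  have rate: "\<bar>c / (c + t)\<bar> \<le> 1" if "t \<ge> 0" for t
    using \<open>c > 0\<close> that by simp
  obtain L where L: "\<And>u v. u \<in> {0..T} \<Longrightarrow> v \<in> {0..T} \<Longrightarrow> norm (x u - x v) \<le> L * \<bar>u - v\<bar>"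
    using frank_wolfe_flow_Lipschitz[OF flow compact_imp_bounded[OF \<open>compact D\<close>] rate \<open>T \<ge> 0\<close>]
    by metis
  show ?thesis
  proof (rule decay_bound_ae[OF \<open>c > 0\<close> \<open>T \<ge> 0\<close> N])
    fix t assume t: "t \<in> {0..T}"
    then have "f differentiable (at (x t))" using diff xD by simp
    from Lipschitz_curve_compose_increment_bigo[OF this t L]
    show "(\<lambda>u. f (x u) - f y - (f (x t) - f y)) \<in> O[at t within {0..T}](\<lambda>u. u - t)"
      by simp
  next
    fix t assume "t \<in> {0<..<T} - N"
    then have t: "t \<ge> 0" "t \<notin> N" by auto
    let ?g = "gradient f (x t)"
    have G: "GDERIV f (x t) :> ?g"
      using diff xD t by (intro differentiable_imp_GDERIV_gradient) simp
    have "((\<lambda>u. f (x u) - f y) has_real_derivative ((c / (c + t)) *\<^sub>R (s t - x t)) \<bullet> ?g) (at t)"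
      using DERIV_diff[OF GDERIV_compose_curve[OF G xd[OF t]] DERIV_const[of "f y"]] by simp
    moreover have "((c / (c + t)) *\<^sub>R (s t - x t)) \<bullet> ?g \<le> (c / (c + t)) * (f y - f (x t))"
    proof -
      have "(s t - x t) \<bullet> ?g \<le> f y - f (x t)"
        using s[OF t \<open>y \<in> D\<close>] convex_on_above_gradient[OF conv xD[OF t(1)] \<open>y \<in> D\<close> G]
        by (simp add: inner_commute)
      then show ?thesis
        unfolding inner_scaleR_left using \<open>c > 0\<close> t by (intro mult_left_mono) simp_all
    qed
    moreover have "(c / (c + t)) * (f y - f (x t)) = - (c / (c + t) * (f (x t) - f y))"
      by (simp only: mult_minus_right[symmetric] minus_diff_eq)
    ultimately show "\<exists>d. ((\<lambda>u. f (x u) - f y) has_real_derivative d) (at t) \<and>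
        d \<le> - (c / (c + t) * (f (x t) - f y))"
      by metis
  qed
qed

section \<open>The convergence rate\<close>

text \<open>Convexity of \<open>f\<close> on \<open>D\<close> supplies the gradient inequality, and
  the start in \<open>D\<close> supplies the invariance. The decay lemma is applied at a minimizer,
  and the resulting product inequality is rearranged into the quotient.\<close>

theorem proposition2p1:
  fixes D :: "(real ^ 'n) set"
    and f :: "real ^ 'n \<Rightarrow> real"
    and s x :: "real \<Rightarrow> real ^ 'n"
    and c fstar :: real
  assumes "convex D" and "compact D"
    and "\<forall>y. f differentiable (at y)"
    and "convex_on D f"
    and "fstar = (LEAST v. v \<in> f ` D)"
    and "c \<ge> 1"
    and "x 0 \<in> D"
    and "frank_wolfe_flow D f (\<lambda>t. c / (c + t)) s x"
  shows "(\<forall>t\<ge>0. (f (x t) - fstar) / (f (x 0) - fstar) \<le> (c / (c + t)) powr c) \<and>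
         (\<lambda>t. (c / (c + t)) powr c) \<in> O[at_top](\<lambda>t. 1 / t powr c)"
proof
  have "c > 0" using \<open>c \<ge> 1\<close> by simp
  have "continuous_on D f"
    using assms(3) by (intro differentiable_imp_continuous_on)
      (auto simp: differentiable_on_def intro: differentiable_at_withinI)
  \<comment> \<open>On the reals \<open>LEAST\<close> is informative only once the minimum is
    attained; compactness gives this, with \<open>x 0\<close> witnessing that \<open>D\<close> is
    nonempty.\<close>
  then obtain y where y: "y \<in> D" "\<And>z. z \<in> D \<Longrightarrow> f y \<le> f z"
    using continuous_attains_inf[OF \<open>compact D\<close>] \<open>x 0 \<in> D\<close> by blast
  have fstar: "fstar = f y"
    unfolding assms(5) by (rule Least_equality) (use y in auto)
  show "\<forall>t\<ge>0. (f (x t) - fstar) / (f (x 0) - fstar) \<le> (c / (c + t)) powr c"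
  proof (intro allI impI)
    fix t :: real assume "t \<ge> 0"
    have "(f (x t) - f y) * (c + t) powr c \<le> (f (x 0) - f y) * c powr c"
      using assms \<open>c > 0\<close> \<open>t \<ge> 0\<close> y by (intro frank_wolfe_flow_decay[where D = D and s = s]) auto
    moreover have "f (x 0) - f y \<ge> 0" using y(2) \<open>x 0 \<in> D\<close> by simp
    moreover have "(c + t) powr c > 0" using \<open>c > 0\<close> \<open>t \<ge> 0\<close> by simp
    \<comment> \<open>If the trajectory starts at a minimizer, the denominator is 0 and the quotient
      is 0 by convention, so the bound holds trivially.\<close>
    ultimately have "(f (x t) - f y) / (f (x 0) - f y) \<le> c powr c / (c + t) powr c"
      by (cases "f (x 0) - f y = 0") (simp_all add: field_simps)
    then show "(f (x t) - fstar) / (f (x 0) - fstar) \<le> (c / (c + t)) powr c"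
      using \<open>c > 0\<close> \<open>t \<ge> 0\<close> by (simp add: fstar powr_divide)
  qed
  \<comment> \<open>Dropping \<open>c\<close> from the denominator \<open>c + t\<close> only
    enlarges the base, so \<open>c powr c\<close> serves as the constant for positive
    \<open>t\<close>.\<close>
  show "(\<lambda>t. (c / (c + t)) powr c) \<in> O[at_top](\<lambda>t. 1 / t powr c)"
  proof (rule landau_o.bigI[of "c powr c"])
    show "c powr c > 0" using \<open>c > 0\<close> by simp
    show "\<forall>\<^sub>F t in at_top. norm ((c / (c + t)) powr c) \<le> c powr c * norm (1 / t powr c)"
      using eventually_gt_at_top[of 0]
    proof eventually_elim
      case (elim t)
      then have "(c / (c + t)) powr c \<le> (c / t) powr c"
        using \<open>c > 0\<close> by (intro powr_mono2) (auto intro!: divide_left_mono)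
      with elim \<open>c > 0\<close> show ?case by (simp add: powr_divide)
    qed
  qed
qed

end
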